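(* Let $r\geqslant 0$ be an integer, let $p=p(x)$, $q=q(x)$ and $u_0(x),\dots,u_r(x)$ be given functions (formal power series in $x$), and consider a sequence $(A_k(x))_{k\geqslant 0}$ with $A_i(x)=u_i(x)$ for $0\leqslant i\leqslant r$ and $$A_k(x)=p\,A_{k-1}(x)\Big(q+\sum_{i=0}^k A_i(x)\Big)\quad\text{for all } k\geqslant r+1.$$ Set $u=u_r(x)$, $v=\sum_{i=0}^r u_i(x)-u$, and $B_k(x)=\sum_{i=0}^k A_i(x)$. Assume this system has a solution, i.e. $1-p\,A_k(x)\neq 0$ for all $k\geqslant r$. Then for every $k\geqslant r+1$, $$B_k(x)=\frac{a+b\,B_{k-1}(x)}{c+d\,B_{k-1}(x)},$$ where $$a=p^2qv(q+u+v)-pqu-u-v,\quad b=-p(pq+1)(q+v+u),\quad c=-p^2v(q+u+v)-qp-pv-1,\quad d=p^2(q+v+u).$$ Moreover $A(x)=\lim_{k\to\infty}B_k(x)=\sum_{k\geqslant 0}A_k(x)$ is a root of the polynomial $d\,A(x)^2+(c-b)\,A(x)-a$.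
   Context: All functions are formal power series in $x$; the limit $A(x)=\lim_{k\to\infty}B_k(x)$ is taken in the sense of formal power series and is assumed to exist (it equals $\sum_{k\geqslant0}A_k(x)$).
   Formalization: The fraction formula is stated only for those k with c+d·B_{k-1} ≠ 0, since it can be 0/0 (r=0, p=-1, q=1, u_0=0); the identity B_k(c+d·B_{k-1}) = a+b·B_{k-1} is proved for all k ≥ r+1. Coefficients lie in an arbitrary field. *)

theory Defs
  imports "HOL-Computational_Algebra.Formal_Power_Series"
begin

end

theory Submission
  imports Defs
begin

text \<open>
  Put $X_k = q + B_k$. The recurrence reads $X_k (1 + p X_{k-2}) = X_{k-1} (1 + p X_k)$, so
  $(1 + p X_k)(1 + p X_{k-1}) / X_k$ does not depend on $k$. Its value at $k = r$, where
  $X_{r-1}$ stands for $q + v$, turns this conservation law into the asserted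
  homographic relation between $B_k$ and $B_{k-1}$, whose fixed point equation is the quadratic.
\<close>

lemma tendsto_fps_add:
  fixes f g :: "'b \<Rightarrow> 'a::ab_group_add fps"
  assumes "(f \<longlongrightarrow> l) F" and "(g \<longlongrightarrow> m) F"
  shows "((\<lambda>x. f x + g x) \<longlongrightarrow> l + m) F"
proof (rule tendsto_fpsI)
  fix n
  show "eventually (\<lambda>x. fps_nth (f x + g x) n = fps_nth (l + m) n) F"
    using assms[unfolded tendsto_fps_iff, rule_format, of n]
    by eventually_elim simp
qed

text \<open>Coefficient \<open>n\<close> of a product involves only the coefficients up to
  \<open>n\<close> of the factors, and these finitely many are all eventually constant.\<close>

lemma tendsto_fps_mult:
  fixes f g :: "'b \<Rightarrow> 'a::ring fps"
  assumes "(f \<longlongrightarrow> l) F" and "(g \<longlongrightarrow> m) F"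
  shows "((\<lambda>x. f x * g x) \<longlongrightarrow> l * m) F"
proof (rule tendsto_fpsI)
  fix n
  have "eventually (\<lambda>x. \<forall>i\<in>{..n}. fps_nth (f x) i = fps_nth l i) F"
    and "eventually (\<lambda>x. \<forall>i\<in>{..n}. fps_nth (g x) i = fps_nth m i) F"
    using assms unfolding tendsto_fps_iff by (simp_all add: eventually_ball_finite)
  then show "eventually (\<lambda>x. fps_nth (f x * g x) n = fps_nth (l * m) n) F"
    by eventually_elim (simp add: fps_mult_nth)
qed

text \<open>The relation is kept free of division, so sums and products suffice to pass to the
  limit. Both sides are eventually the same sequence, and uniqueness of limits gives the fixed point
  equation.\<close>

lemma homographic_limit:
  fixes f :: "nat \<Rightarrow> 'a::comm_ring_1 fps"
  assumes lim: "f \<longlonglongrightarrow> L"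
    and rel: "\<And>k. k \<ge> N \<Longrightarrow> f (Suc k) * (c + d * f k) = a + b * f k"
  shows "L * (c + d * L) = a + b * L"
proof (rule LIMSEQ_unique)
  have "(\<lambda>k. f (Suc k) * (c + d * f k)) \<longlonglongrightarrow> L * (c + d * L)"
    by (intro tendsto_fps_mult tendsto_fps_add tendsto_const LIMSEQ_Suc lim)
  moreover have "eventually (\<lambda>k. f (Suc k) * (c + d * f k) = a + b * f k) sequentially"
    using rel by (auto simp: eventually_sequentially)
  ultimately show "(\<lambda>k. a + b * f k) \<longlonglongrightarrow> L * (c + d * L)"
    by (simp add: tendsto_cong)
  show "(\<lambda>k. a + b * f k) \<longlonglongrightarrow> a + b * L"
    by (intro tendsto_fps_mult tendsto_fps_add tendsto_const lim)
qed

text \<open>The conservation law with denominators cleared; it also holds in the degenerate case where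
  one, and then every, \<open>X k\<close> vanishes.\<close>

lemma conserved_product:
  fixes X :: "nat \<Rightarrow> 'a::idom" and p w :: 'a
  defines "Y \<equiv> \<lambda>k. if k = 0 then w else X (k - 1)"
  assumes step: "\<And>k. X (Suc k) - X k = p * (X k - Y k) * X (Suc k)"
    and solvable: "\<And>k. 1 - p * (X k - Y k) \<noteq> 0"
  shows "(1 + p * X k) * (1 + p * Y k) * X 0 = X k * ((1 + p * X 0) * (1 + p * w))"
proof (induction k)
  case 0
  show ?case by (simp add: Y_def)
next
  case (Suc k)
  have X_eq: "X k = (1 - p * (X k - Y k)) * X (Suc k)" for k
    using step[of k] by (simp add: algebra_simps)
  show ?case
  proof (cases "X k = 0")
    \<comment> \<open>Both sides vanish here: a zero of \<open>X\<close> spreads forward because the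
      factor in \<open>X_eq\<close> is nonzero, and back to index 0 because \<open>X k\<close> is a
      multiple of \<open>X (Suc k)\<close>.\<close>
    case True
    then have "X (Suc k) = 0"
      using X_eq[of k] solvable[of k] by (metis mult_eq_0_iff)
    moreover have "X 0 = 0"
      using True
    proof (induction k)
      case (Suc k)
      then show ?case using X_eq[of k] by (metis mult_zero_right)
    qed
    ultimately show ?thesis by simp
  next
    case False
    let ?C = "(1 + p * X 0) * (1 + p * w)"
    \<comment> \<open>This exchange carries the law from \<open>k\<close> to \<open>Suc k\<close>
      once the goal is multiplied by \<open>X k\<close>, which is cancelled at the end in the
      integral domain.\<close>
    have exch: "X k * (1 + p * X (Suc k)) = X (Suc k) * (1 + p * Y k)"
      using step[of k] by (simp add: algebra_simps)
    have "X k * ((1 + p * X (Suc k)) * (1 + p * X k) * X 0)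
        = (X k * (1 + p * X (Suc k))) * ((1 + p * X k) * X 0)"
      by (simp only: mult_ac)
    also have "\<dots> = X (Suc k) * ((1 + p * X k) * (1 + p * Y k) * X 0)"
      by (simp only: exch mult_ac)
    also have "\<dots> = X k * (X (Suc k) * ?C)"
      by (simp only: Suc.IH) (simp only: mult_ac)
    finally show ?thesis using False by (simp add: Y_def)
  qed
qed

theorem theorem1:
  fixes r :: nat
    and p q :: "'a::field fps"
    and us A :: "nat \<Rightarrow> 'a fps"
  defines "u \<equiv> us r"
  defines "v \<equiv> (\<Sum>i\<le>r. us i) - u"
  defines "B \<equiv> (\<lambda>k. \<Sum>i\<le>k. A i)"
  defines "a \<equiv> p^2 * q * v * (q + u + v) - p * q * u - u - v"
  defines "b \<equiv> - p * (p * q + 1) * (q + v + u)"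
  defines "c \<equiv> - (p^2) * v * (q + u + v) - q * p - p * v - 1"
  defines "d \<equiv> p^2 * (q + v + u)"
  assumes init: "\<And>i. i \<le> r \<Longrightarrow> A i = us i"
    and rec: "\<And>k. k \<ge> r + 1 \<Longrightarrow> A k = p * A (k - 1) * (q + (\<Sum>i\<le>k. A i))"
    and solvable: "\<And>k. k \<ge> r \<Longrightarrow> 1 - p * A k \<noteq> 0"
  shows "(\<forall>k \<ge> r + 1.
            B k * (c + d * B (k - 1)) = a + b * B (k - 1) \<and>
            (c + d * B (k - 1) \<noteq> 0 \<longrightarrow>
               B k = (a + b * B (k - 1)) / (c + d * B (k - 1)))) \<and>
         (convergent B \<longrightarrow>
            A sums lim B \<and>
            d * (lim B)^2 + (c - b) * lim B - a = 0)"
proof -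
  \<comment> \<open>Indices are shifted by \<open>r\<close>, so that the recurrence governs every
    step from \<open>X j\<close> to \<open>X (Suc j)\<close>. \<open>Y j\<close> is the predecessor
    of \<open>X j\<close>; the value \<open>q + v\<close> at 0 replaces
    \<open>q + B (r - 1)\<close>, which would be wrong for \<open>r = 0\<close> under truncated
    subtraction.\<close>
  define X where "X = (\<lambda>j. q + B (r + j))"
  define Y where "Y = (\<lambda>j. if j = 0 then q + v else X (j - 1))"
  have B_Suc: "B (Suc k) = B k + A (Suc k)" for k
    by (simp add: B_def)
  have "B r = (\<Sum>i\<le>r. us i)"
    unfolding B_def by (rule sum.cong) (auto simp: init)
  then have B_r: "B r = v + u"
    by (simp add: v_def)
  have diff: "X j - Y j = A (r + j)" for j
    by (cases j) (simp_all add: X_def Y_def B_Suc B_r u_def init)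
  have step: "X (Suc j) - X j = p * (X j - Y j) * X (Suc j)" for j
    using rec[of "Suc (r + j)"] unfolding diff by (simp add: X_def B_def)
  have "1 - p * (X j - Y j) \<noteq> 0" for j
    unfolding diff by (rule solvable) simp
  then have conserved:
    "(1 + p * X j) * (1 + p * Y j) * X 0 = X j * ((1 + p * X 0) * (1 + p * (q + v)))" for j
    using conserved_product[of X p "q + v" j] step unfolding Y_def by blast
  have rel: "B (Suc k) * (c + d * B k) = a + b * B k" if "k \<ge> r" for k
  proof -
    obtain j where k: "k = r + j"
      using le_Suc_ex[OF \<open>k \<ge> r\<close>] by blast
    \<comment> \<open>The law is taken at \<open>Suc j\<close>, where it links
      \<open>B (Suc k)\<close> to \<open>B k\<close>.\<close>
    have "X (Suc j) = q + B (Suc k)" "Y (Suc j) = q + B k" "X 0 = q + (v + u)"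
      by (simp_all add: X_def Y_def k B_r)
    then have "(1 + p * (q + B (Suc k))) * (1 + p * (q + B k)) * (q + (v + u))
        = (q + B (Suc k)) * ((1 + p * (q + (v + u))) * (1 + p * (q + v)))"
      using conserved[of "Suc j"] by (simp only:)
    \<comment> \<open>The two sides of the relation differ by exactly as much as those of the
      conservation law: expanding the latter, the terms in the product of the two \<open>B\<close>
      values cancel down to \<open>d\<close>, and \<open>a\<close>, \<open>b\<close>,
      \<open>c\<close> are the remaining coefficients up to sign.\<close>
    moreover have "B (Suc k) * (c + d * B k) - (a + b * B k)
        = (1 + p * (q + B (Suc k))) * (1 + p * (q + B k)) * (q + (v + u))
          - (q + B (Suc k)) * ((1 + p * (q + (v + u))) * (1 + p * (q + v)))"
      unfolding a_def b_def c_def d_def by (simp add: algebra_simps power2_eq_square)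
    ultimately show ?thesis by (simp only: right_minus_eq diff_self)
  qed
  have "B k * (c + d * B (k - 1)) = a + b * B (k - 1) \<and>
      (c + d * B (k - 1) \<noteq> 0 \<longrightarrow> B k = (a + b * B (k - 1)) / (c + d * B (k - 1)))"
    if "k \<ge> r + 1" for k
  proof -
    have "B k * (c + d * B (k - 1)) = a + b * B (k - 1)"
      using rel[of "k - 1"] that by simp
    \<comment> \<open>A nonzero denominator is enough, even if its constant term is 0: dividing a
      product by one nonzero factor returns the other.\<close>
    then show ?thesis
      using nonzero_mult_div_cancel_right[of "c + d * B (k - 1)" "B k"] by simp
  qed
  moreover have "A sums lim B \<and> d * (lim B)^2 + (c - b) * lim B - a = 0" if "convergent B"
  proof
    have lim: "B \<longlonglongrightarrow> lim B"
      using that by (simp add: convergent_LIMSEQ_iff)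
    then show "A sums lim B"
      by (simp add: sums_def_le B_def)
    show "d * (lim B)^2 + (c - b) * lim B - a = 0"
      using homographic_limit[OF lim rel] by (simp add: algebra_simps power2_eq_square)
  qed
  ultimately show ?thesis by blast
qed

end
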